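(* For any $\varepsilon,\alpha>0$ there is $n_0$ such that the following holds for all integers $n\ge n_0$. Let $a_1,\ldots,a_k$ be a sequence of real numbers such that $\sum_{i=1}^{k}a_i\le(1-\varepsilon)n$ and $a_i\ge\alpha n$ for all $i\in\{1,\ldots,k\}$. Then for any $k$ pairwise edge-disjoint perfect matchings $M_1,\ldots,M_k$ of the complete graph $K_{2n}$ there is a matching $M$ in $K_{2n}$ such that $|M\cap M_i|\ge a_i$ for all $i\in\{1,\ldots,k\}$.
   Context: $K_{2n}$ denotes the complete graph on $2n$ vertices. Matchings are regarded as sets of edges. *)

theory Defs
  imports Complex_Main "HOL-Library.Ramsey" "HOL-Library.Disjoint_Sets"
begin

text \<open>A simple graph is given by a vertex set and a set of two-element subsets of it.
  The complete graph on \<open>m\<close> vertices is realised on \<open>{..<m}\<close>.\<close>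

definition complete_verts :: "nat \<Rightarrow> nat set" where
  "complete_verts m = {..<m}"

definition complete_edges :: "nat \<Rightarrow> nat set set" where
  "complete_edges m = nsets (complete_verts m) 2"

definition is_matching :: "'a set set \<Rightarrow> 'a set set \<Rightarrow> bool" where
  "is_matching E M \<longleftrightarrow> M \<subseteq> E \<and> disjoint M"

definition is_perfect_matching :: "'a set \<Rightarrow> 'a set set \<Rightarrow> 'a set set \<Rightarrow> bool" where
  "is_perfect_matching V E M \<longleftrightarrow> is_matching E M \<and> \<Union>M = V"

end

theory Submission
  imports Defs
begin

text \<open>
  The matchings achieving almost prescribed intersections with \<open>M\<^sub>1, \<dots>, M\<^sub>k\<close> behave like a
  convex set. Given two matchings \<open>A\<close>, \<open>B\<close> and \<open>t \<in> [0, 1]\<close>, there is a matching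
  \<open>C \<subseteq> A \<union> B\<close> with \<open>|C \<inter> M\<^sub>i| \<ge> t |A \<inter> M\<^sub>i| + (1 - t) |B \<inter> M\<^sub>i| - o(n)\<close> for all \<open>i\<close>
  (lemma \<open>mix_two_matchings\<close>). To see this, observe that \<open>A \<union> B\<close> has maximum degree two, so
  deleting \<open>O(n / L)\<close> of its edges breaks it into pieces of at most \<open>L\<close> vertices
  (\<open>cut_into_bounded_pieces\<close>). In every piece one may use either the edges of \<open>A\<close> or those
  of \<open>B\<close>, independently of the other pieces, and the result is a matching. Choosing \<open>A\<close> with
  probability \<open>t\<close> in each piece gives the right expectations, and as every piece contributes at most
  \<open>L\<close> to each intersection, the total variance is at most \<open>k L\<^sup>2 n\<close> up to a constant factor, so that some
  choice deviates by only \<open>O(L sqrt (k n))\<close> (\<open>subset_sum_near_multiple\<close>).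

  Mixing in the given matchings one after the other yields, for any convex weights \<open>w\<^sub>i\<close>, a matching
  meeting each \<open>M\<^sub>i\<close> in at least \<open>w\<^sub>i n\<close> edges up to \<open>k\<close> times the error of one mixing
  (\<open>mix_matchings\<close>). With \<open>w\<^sub>i = a\<^sub>i / s\<close> and \<open>s = a\<^sub>1 + \<dots> + a\<^sub>k \<le> (1 - \<epsilon>) n\<close> the target
  \<open>w\<^sub>i n\<close> exceeds \<open>a\<^sub>i\<close> by at least \<open>\<epsilon> a\<^sub>i \<ge> \<epsilon> \<alpha> n\<close>. Since the lower bounds on the
  \<open>a\<^sub>i\<close> force \<open>k \<le> 1 / \<alpha>\<close>, choosing first \<open>L\<close> and then \<open>n\<close> large brings the error below
  this surplus.
\<close>

section \<open>Cutting graphs of maximum degree two into bounded pieces\<close>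

definition edge_boundary :: "'a set set \<Rightarrow> 'a set \<Rightarrow> 'a set set" where
  "edge_boundary E S = {e \<in> E. e \<inter> S \<noteq> {} \<and> \<not> e \<subseteq> S}"

text \<open>
  Grow the set from a single vertex, always absorbing the outer endpoint \<open>y\<close> of some boundary edge.
  This edge leaves the boundary, and as \<open>y\<close> has degree at most two, at most one new edge enters it;
  so the boundary never exceeds two edges. Growth stops early only when the boundary is empty.
\<close>

lemma exists_set_small_boundary:
  assumes E: "finite E" "E \<subseteq> nsets W 2"
    and deg: "\<And>v. card {e \<in> E. v \<in> e} \<le> 2"
    and W: "finite W" "W \<noteq> {}" and L: "1 \<le> L"
  shows "\<exists>S\<subseteq>W. S \<noteq> {} \<and> card S \<le> L \<and> card (edge_boundary E S) \<le> 2
           \<and> (card S = L \<or> edge_boundary E S = {})"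
  using L
proof (induction L rule: dec_induct)
  case base
  obtain v where v: "v \<in> W" using W by auto
  have "edge_boundary E {v} \<subseteq> {e \<in> E. v \<in> e}"
    by (auto simp: edge_boundary_def)
  then have "card (edge_boundary E {v}) \<le> 2"
    using deg[of v] E(1) card_mono[of "{e \<in> E. v \<in> e}" "edge_boundary E {v}"] by simp
  then show ?case using v by (intro exI[of _ "{v}"]) auto
next
  case (step L)
  then obtain S where S: "S \<subseteq> W" "S \<noteq> {}" "card S \<le> L" "card (edge_boundary E S) \<le> 2"
    and S': "card S = L \<or> edge_boundary E S = {}" by blast
  show ?case
  proof (cases "edge_boundary E S = {}")
    case True
    with S show ?thesis by (intro exI[of _ S]) auto
  next
    case False
    then obtain e where e: "e \<in> edge_boundary E S" by blast
    then have eE: "e \<in> E" by (auto simp: edge_boundary_def)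
    then obtain x y where xy: "e = {x, y}" "x \<noteq> y" "x \<in> S" "y \<notin> S"
      using e E(2) by (fastforce simp: edge_boundary_def nsets_def card_2_iff)
    have yW: "y \<in> W" using eE xy E(2) by (auto simp: nsets_def)
    let ?T = "insert y S"
    let ?D = "{f \<in> E. y \<in> f}"
    have fin: "finite (edge_boundary E S)" "finite ?D"
      using E(1) by (auto simp: edge_boundary_def)
    have "edge_boundary E ?T \<subseteq> (edge_boundary E S - {e}) \<union> (?D - {e})"
      using xy by (auto simp: edge_boundary_def)
    then have "card (edge_boundary E ?T) \<le> card ((edge_boundary E S - {e}) \<union> (?D - {e}))"
      using fin by (intro card_mono) auto
    also have "\<dots> \<le> card (edge_boundary E S - {e}) + card (?D - {e})"
      by (rule card_Un_le)
    also have "\<dots> = (card (edge_boundary E S) - 1) + (card ?D - 1)"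
      using e eE xy fin by simp
    also have "\<dots> \<le> 2" using S(4) deg[of y] by linarith
    finally have "card (edge_boundary E ?T) \<le> 2" .
    moreover have "card ?T = Suc L"
      using S S' False xy(4) W(1) by (simp add: finite_subset)
    ultimately show ?thesis using S(1) yW by (intro exI[of _ ?T]) auto
  qed
qed

text \<open>
  Repeatedly split off a set from the previous lemma and delete its boundary. The cost is charged to
  the vertices split off: at most two edges are deleted for a set of exactly \<open>L\<close> vertices, and none for
  a smaller one.
\<close>

lemma cut_into_bounded_pieces:
  assumes "finite W" "E \<subseteq> nsets W 2" "\<And>v. card {e \<in> E. v \<in> e} \<le> 2" "1 \<le> L"
  shows "\<exists>P F. finite P \<and> disjoint P \<and> \<Union>P \<subseteq> W \<and> card P \<le> card W \<and> (\<forall>p\<in>P. card p \<le> L)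
           \<and> F \<subseteq> E \<and> L * card F \<le> 2 * card W \<and> (\<forall>e\<in>E - F. \<exists>p\<in>P. e \<subseteq> p)"
  using assms(1-3)
proof (induction "card W" arbitrary: W E rule: less_induct)
  case less
  have finE: "finite E" 
    using less.prems(1,2) by (meson finite_imp_finite_nsets finite_subset)
  show ?case
  proof (cases "W = {}")
    case True
    then have "E = {}" using less.prems(2) by (auto simp: nsets_def)
    then show ?thesis by (intro exI[of _ "{}"]) auto
  next
    case False
    obtain S where S: "S \<subseteq> W" "S \<noteq> {}" "card S \<le> L" "card (edge_boundary E S) \<le> 2"
      and S': "card S = L \<or> edge_boundary E S = {}"
      using exists_set_small_boundary[OF finE less.prems(2,3,1) False assms(4)] by blast
    define E' where "E' = {e \<in> E. e \<inter> S = {}}"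
    have finS: "finite S" using S(1) less.prems(1) finite_subset by blast
    have cardW: "card W = card S + card (W - S)"
      using S(1) finS less.prems(1) by (simp add: card_Diff_subset card_mono)
    moreover have cS: "1 \<le> card S" using finS S(2) by (simp add: Suc_le_eq card_gt_0_iff)
    ultimately have "card (W - S) < card W" by linarith
    moreover have "E' \<subseteq> nsets (W - S) 2" using less.prems(2) by (auto simp: E'_def nsets_def)
    moreover have "card {e \<in> E'. v \<in> e} \<le> 2" for v
    proof -
      have "card {e \<in> E'. v \<in> e} \<le> card {e \<in> E. v \<in> e}"
        using finE by (intro card_mono) (auto simp: E'_def)
      then show ?thesis using less.prems(3)[of v] by linarith
    qed
    ultimately obtain P F where P: "finite P" "disjoint P" "\<Union>P \<subseteq> W - S" "card P \<le> card (W - S)"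
        "\<forall>p\<in>P. card p \<le> L" and F: "F \<subseteq> E'" "L * card F \<le> 2 * card (W - S)"
        and cov: "\<forall>e\<in>E' - F. \<exists>p\<in>P. e \<subseteq> p"
      using less.hyps[of "W - S" E'] less.prems(1) by blast
    let ?F = "edge_boundary E S \<union> F"
    have "L * card (edge_boundary E S) \<le> 2 * card S"
      using S' S(4) by auto
    moreover have "L * card ?F \<le> L * card (edge_boundary E S) + L * card F"
      using card_Un_le[of "edge_boundary E S" F] by (metis add_mult_distrib2 mult_le_mono2)
    ultimately have "L * card ?F \<le> 2 * card W" using F(2) cardW by linarith
    moreover have "disjoint (insert S P)"
      using P(2,3) by (auto simp: pairwise_insert disjnt_def)
    moreover have "card (insert S P) \<le> card W"
      using P(1,4) cS cardW by (simp add: card_insert_if)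
    moreover have "\<exists>p\<in>insert S P. e \<subseteq> p" if "e \<in> E - ?F" for e
    proof (cases "e \<inter> S = {}")
      case True
      then show ?thesis using that cov by (auto simp: E'_def)
    next
      case False
      then show ?thesis using that by (auto simp: edge_boundary_def)
    qed
    moreover have "\<Union>(insert S P) \<subseteq> W" "\<forall>p\<in>insert S P. card p \<le> L" "finite (insert S P)"
      using P(1,3,5) S(1,3) by auto
    moreover have "?F \<subseteq> E" using F(1) by (auto simp: E'_def edge_boundary_def)
    moreover note pieces = calculation
    show ?thesis
      by (rule exI[of _ "insert S P"], rule exI[of _ ?F]) (use pieces in blast)
  qed
qed

section \<open>Rounding a multiple of a vector sum\<close>

text \<open>
  If \<open>Q\<close> contains each \<open>p\<close> independently with probability \<open>t\<close>, the expected squared distance of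
  its sum from \<open>t\<close> times the full sum is \<open>t (1 - t)\<close> times the sum of the squared norms, so some
  \<open>Q\<close> does at least as well. The proof makes these choices one by one, by conditional expectations.
\<close>

lemma subset_sum_near_multiple:
  fixes v :: "'p \<Rightarrow> 'i \<Rightarrow> real"
  assumes "finite P" "0 \<le> t" "t \<le> 1"
  shows "\<exists>Q\<subseteq>P. (\<Sum>i\<in>I. ((\<Sum>p\<in>Q. v p i) - t * (\<Sum>p\<in>P. v p i))\<^sup>2) \<le> (\<Sum>p\<in>P. \<Sum>i\<in>I. (v p i)\<^sup>2)"
  using assms(1)
proof induction
  case empty
  then show ?case by simp
next
  case (insert q P)
  then obtain Q where Q: "Q \<subseteq> P"
    "(\<Sum>i\<in>I. ((\<Sum>p\<in>Q. v p i) - t * (\<Sum>p\<in>P. v p i))\<^sup>2) \<le> (\<Sum>p\<in>P. \<Sum>i\<in>I. (v p i)\<^sup>2)" by blast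
  define d where "d i = (\<Sum>p\<in>Q. v p i) - t * (\<Sum>p\<in>P. v p i)" for i
  define X where "X = (\<Sum>i\<in>I. (d i + (1 - t) * v q i)\<^sup>2)"
  define Y where "Y = (\<Sum>i\<in>I. (d i - t * v q i)\<^sup>2)"
  let ?N = "\<Sum>i\<in>I. (v q i)\<^sup>2"
  have finQ: "finite Q" "q \<notin> Q" using Q(1) insert.hyps finite_subset by auto
  \<comment> \<open>\<open>X\<close> and \<open>Y\<close> are the errors with and without \<open>q\<close>; in their \<open>t\<close>-average the terms
    that are linear in \<open>v q\<close> cancel.\<close>
  have "t * X + (1 - t) * Y = (\<Sum>i\<in>I. (d i)\<^sup>2 + t * (1 - t) * (v q i)\<^sup>2)"
    unfolding X_def Y_def sum_distrib_left sum.distrib[symmetric]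
    by (intro sum.cong refl) (simp add: algebra_simps power2_eq_square)
  also have "\<dots> \<le> (\<Sum>i\<in>I. (d i)\<^sup>2) + ?N"
  proof -
    have "t * (1 - t) \<le> 1" using assms by (simp add: mult_le_one)
    then have "t * (1 - t) * (v q i)\<^sup>2 \<le> (v q i)\<^sup>2" for i
      by (meson mult_left_le_one_le assms mult_nonneg_nonneg diff_ge_0_iff_ge zero_le_power2)
    then show ?thesis by (simp add: sum.distrib[symmetric] sum_mono)
  qed
  finally have avg: "t * X + (1 - t) * Y \<le> (\<Sum>i\<in>I. (d i)\<^sup>2) + ?N" .
  have "min X Y = t * min X Y + (1 - t) * min X Y" by (simp add: algebra_simps)
  also have "\<dots> \<le> t * X + (1 - t) * Y"
    using assms by (intro add_mono mult_left_mono) auto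
  finally have "min X Y \<le> (\<Sum>p\<in>insert q P. \<Sum>i\<in>I. (v p i)\<^sup>2)"
    using avg Q(2) insert.hyps by (simp add: d_def)
  moreover have "X = (\<Sum>i\<in>I. ((\<Sum>p\<in>insert q Q. v p i) - t * (\<Sum>p\<in>insert q P. v p i))\<^sup>2)"
    unfolding X_def d_def using finQ insert.hyps by (intro sum.cong) (auto simp: algebra_simps)
  moreover have "Y = (\<Sum>i\<in>I. ((\<Sum>p\<in>Q. v p i) - t * (\<Sum>p\<in>insert q P. v p i))\<^sup>2)"
    unfolding Y_def d_def using insert.hyps by (intro sum.cong) (auto simp: algebra_simps)
  ultimately show ?case
    using Q(1) by (cases "X \<le> Y") (auto simp: min_def intro: exI[of _ "insert q Q"] exI[of _ Q])
qed

section \<open>Mixing matchings\<close>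

lemma card_disjoint_le_card_Union:
  assumes "disjoint A" "{} \<notin> A" "finite (\<Union>A)"
  shows "card A \<le> card (\<Union>A)"
proof -
  have fin: "finite e" if "e \<in> A" for e
    using assms(3) that by (meson Union_upper finite_subset)
  have "card A = (\<Sum>e\<in>A. 1)" by simp
  also have "\<dots> \<le> (\<Sum>e\<in>A. card e)"
    using fin assms(2) by (intro sum_mono) (metis One_nat_def Suc_leI card_gt_0_iff)
  also have "\<dots> = card (\<Union>A)" using assms(1) fin by (simp add: card_Union_disjoint)
  finally show ?thesis .
qed

lemma disjoint_degree_le_1:
  assumes "disjoint A"
  shows "card {e \<in> A. v \<in> e} \<le> 1" 
proof -
  have "e = f" if "e \<in> A" "f \<in> A" "v \<in> e" "v \<in> f" for e f
    using assms that by (metis disjnt_iff pairwiseD)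
  then have "{e \<in> A. v \<in> e} = {} \<or> (\<exists>e. {e \<in> A. v \<in> e} = {e})" by blast
  then show ?thesis by (metis card.empty card_1_singleton_iff One_nat_def le_refl zero_le)
qed

lemma card_edges_inside_pieces:
  assumes "finite A" "{} \<notin> A" "finite P" "disjoint P"
  shows "card {e \<in> A. \<exists>p\<in>P. e \<subseteq> p} = (\<Sum>p\<in>P. card {e \<in> A. e \<subseteq> p})"
proof -
  have "{e \<in> A. \<exists>p\<in>P. e \<subseteq> p} = (\<Union>p\<in>P. {e \<in> A. e \<subseteq> p})" by auto
  moreover have "{e \<in> A. e \<subseteq> p} \<inter> {e \<in> A. e \<subseteq> q} = {}" if "p \<in> P" "q \<in> P" "p \<noteq> q" for p q
  proof -
    have "p \<inter> q = {}" using assms(4) that by (simp add: disjointD)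
    then have "e = {}" if "e \<subseteq> p" "e \<subseteq> q" for e using that by blast
    then show ?thesis using assms(2) by blast
  qed
  ultimately show ?thesis using assms by (simp add: card_UN_disjoint)
qed

text \<open>
  The two error terms have different sources: \<open>2 |V| / L\<close> bounds the number of edges deleted when
  cutting \<open>A \<union> B\<close> into pieces, and \<open>L sqrt (|I| |V|)\<close> is the rounding error, coming from at most
  \<open>|V|\<close> vectors of \<open>|I|\<close> entries of absolute value at most \<open>L\<close>.
\<close>

lemma mix_two_matchings:
  fixes A B :: "'a set set" and M :: "'i \<Rightarrow> 'a set set" and t :: real and L :: nat
  assumes V: "finite V" and A: "A \<subseteq> nsets V 2" "disjoint A" and B: "B \<subseteq> nsets V 2" "disjoint B"
    and I: "finite I" and L: "1 \<le> L" and t: "0 \<le> t" "t \<le> 1"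
  shows "\<exists>C \<subseteq> nsets V 2. disjoint C \<and> (\<forall>i\<in>I. real (card (C \<inter> M i)) \<ge>
           t * card (A \<inter> M i) + (1 - t) * card (B \<inter> M i)
             - (2 * card V / L + L * sqrt (card I * card V)))"
proof -
  have finAB: "finite A" "finite B"
    using A(1) B(1) V by (meson finite_imp_finite_nsets finite_subset)+
  have ne: "{} \<notin> A" "{} \<notin> B" using A(1) B(1) by (auto simp: nsets_def)
  have deg: "card {e \<in> A \<union> B. v \<in> e} \<le> 2" for v
  proof -
    have "{e \<in> A \<union> B. v \<in> e} = {e \<in> A. v \<in> e} \<union> {e \<in> B. v \<in> e}" by auto
    then show ?thesis
      using card_Un_le[of "{e \<in> A. v \<in> e}" "{e \<in> B. v \<in> e}"]
        disjoint_degree_le_1[OF A(2), of v] disjoint_degree_le_1[OF B(2), of v] by simp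
  qed
  obtain P F where P: "finite P" "disjoint P" "\<Union>P \<subseteq> V" "card P \<le> card V" "\<forall>p\<in>P. card p \<le> L"
    and F: "F \<subseteq> A \<union> B" "L * card F \<le> 2 * card V" and cov: "\<forall>e\<in>A \<union> B - F. \<exists>p\<in>P. e \<subseteq> p"
    using cut_into_bounded_pieces[OF V _ deg L] A(1) B(1) by (metis Un_least)
  define num where "num X p i = real (card {e \<in> X \<inter> M i. e \<subseteq> p})" for X p i
  \<comment> \<open>the change of the intersection with \<open>M i\<close> when \<open>p\<close> is switched from \<open>B\<close> to \<open>A\<close>\<close>
  define v where "v p i = num A p i - num B p i" for p i
  have num_bounds: "0 \<le> num X p i" "num X p i \<le> L"
    if X: "X \<subseteq> nsets V 2" "disjoint X" and p: "p \<in> P" for X p i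
  proof -
    let ?X = "{e \<in> X \<inter> M i. e \<subseteq> p}"
    have "finite p" using p P(3) V by (meson Union_upper finite_subset)
    moreover have "\<Union>?X \<subseteq> p" by auto
    ultimately have "card (\<Union>?X) \<le> card p" "finite (\<Union>?X)"
      by (auto intro: card_mono finite_subset)
    moreover have "card ?X \<le> card (\<Union>?X)"
      using X \<open>finite (\<Union>?X)\<close>
      by (intro card_disjoint_le_card_Union) (auto simp: nsets_def pairwise_def)
    ultimately show "num X p i \<le> L" using P(5) p by (fastforce simp: num_def)
  qed (simp add: num_def)
  have v_le: "(v p i)\<^sup>2 \<le> (real L)\<^sup>2" if "p \<in> P" for p i
  proof -
    have "\<bar>v p i\<bar> \<le> L"
      using num_bounds[OF A that, of i] num_bounds[OF B that, of i] by (simp add: v_def)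
    then show ?thesis using power_mono[of "\<bar>v p i\<bar>" "real L" 2] by simp
  qed
  obtain Q where Q: "Q \<subseteq> P"
    "(\<Sum>i\<in>I. ((\<Sum>p\<in>Q. v p i) - t * (\<Sum>p\<in>P. v p i))\<^sup>2) \<le> (\<Sum>p\<in>P. \<Sum>i\<in>I. (v p i)\<^sup>2)"
    using subset_sum_near_multiple[OF P(1) t] by blast
  define C where "C = {e \<in> A. \<exists>p\<in>Q. e \<subseteq> p} \<union> {e \<in> B. \<exists>p\<in>P - Q. e \<subseteq> p}"
  have apart: "p \<inter> q = {}" if "p \<in> Q" "q \<in> P - Q" for p q
    using that Q(1) P(2) by (auto dest: disjointD)
  have dC: "disjoint C"
  proof (rule disjointI)
    fix e f assume ef: "e \<in> C" "f \<in> C" "e \<noteq> f"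
    have cross: "g \<inter> h = {}" if "g \<subseteq> p" "h \<subseteq> q" "p \<in> Q" "q \<in> P - Q" for g h p q
      using that apart[of p q] by blast
    consider "e \<in> A" "f \<in> A" | "e \<in> B" "f \<in> B"
      | p q where "p \<in> Q" "q \<in> P - Q" "e \<subseteq> p \<and> f \<subseteq> q \<or> f \<subseteq> p \<and> e \<subseteq> q"
      using ef(1,2) unfolding C_def by blast
    then show "e \<inter> f = {}"
    proof cases
      case 1
      then show ?thesis using A(2) ef(3) by (simp add: disjointD)
    next
      case 2
      then show ?thesis using B(2) ef(3) by (simp add: disjointD)
    next
      case 3
      then show ?thesis using cross by (metis Int_commute)
    qed
  qed
  have main: "real (card (C \<inter> M i)) \<ge> t * card (A \<inter> M i) + (1 - t) * card (B \<inter> M i)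
             - (2 * card V / L + L * sqrt (card I * card V))" if i: "i \<in> I" for i
  proof -
    have lost: "real (card (X \<inter> M i)) - card F \<le> (\<Sum>p\<in>P. num X p i)"
      if X: "X \<subseteq> A \<union> B" for X
    proof -
      have finX: "finite X" using finAB X finite_subset by blast
      have finF: "finite F" using F(1) finAB finite_subset by blast
      have "X \<inter> M i \<subseteq> {e \<in> X \<inter> M i. \<exists>p\<in>P. e \<subseteq> p} \<union> F" using cov X by blast
      then have "card (X \<inter> M i) \<le> card ({e \<in> X \<inter> M i. \<exists>p\<in>P. e \<subseteq> p} \<union> F)"
        using finX finF by (intro card_mono) auto
      also have "\<dots> \<le> card {e \<in> X \<inter> M i. \<exists>p\<in>P. e \<subseteq> p} + card F" by (rule card_Un_le)
      also have "card {e \<in> X \<inter> M i. \<exists>p\<in>P. e \<subseteq> p} = (\<Sum>p\<in>P. card {e \<in> X \<inter> M i. e \<subseteq> p})"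
        using finX X ne P by (intro card_edges_inside_pieces) auto
      finally show ?thesis by (simp add: num_def flip: of_nat_sum)
    qed
    let ?d = "(\<Sum>p\<in>Q. v p i) - t * (\<Sum>p\<in>P. v p i)"
    have "?d\<^sup>2 \<le> (\<Sum>i\<in>I. ((\<Sum>p\<in>Q. v p i) - t * (\<Sum>p\<in>P. v p i))\<^sup>2)"
      using i I by (intro member_le_sum[of i I "\<lambda>i. ((\<Sum>p\<in>Q. v p i) - t * (\<Sum>p\<in>P. v p i))\<^sup>2"]) auto
    also have "\<dots> \<le> (\<Sum>p\<in>P. \<Sum>i\<in>I. (v p i)\<^sup>2)" by (rule Q(2))
    also have "\<dots> \<le> (\<Sum>p\<in>P. \<Sum>i\<in>I. (real L)\<^sup>2)" by (intro sum_mono v_le)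
    also have "\<dots> = (real L)\<^sup>2 * (card I * card P)" by simp
    also have "\<dots> \<le> (real L)\<^sup>2 * (card I * card V)"
      using P(4) by (intro mult_left_mono) (simp_all flip: of_nat_mult)
    finally have "\<bar>?d\<bar> \<le> sqrt ((real L)\<^sup>2 * (card I * card V))"
      by (metis real_le_rsqrt real_sqrt_abs real_sqrt_le_iff)
    then have dev: "\<bar>?d\<bar> \<le> L * sqrt (card I * card V)" by (simp add: real_sqrt_mult)
    have "C \<inter> M i = {e \<in> A \<inter> M i. \<exists>p\<in>Q. e \<subseteq> p} \<union> {e \<in> B \<inter> M i. \<exists>p\<in>P - Q. e \<subseteq> p}"
      by (auto simp: C_def)
    moreover have "{e \<in> A \<inter> M i. \<exists>p\<in>Q. e \<subseteq> p} \<inter> {e \<in> B \<inter> M i. \<exists>p\<in>P - Q. e \<subseteq> p} = {}"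
    proof -
      have "e = {}" if "e \<subseteq> p" "e \<subseteq> q" "p \<in> Q" "q \<in> P - Q" for e p q
        using that apart[of p q] by blast
      then show ?thesis using ne by blast
    qed
    ultimately have "card (C \<inter> M i) = card {e \<in> A \<inter> M i. \<exists>p\<in>Q. e \<subseteq> p}
        + card {e \<in> B \<inter> M i. \<exists>p\<in>P - Q. e \<subseteq> p}"
      using finAB by (simp add: card_Un_disjoint)
    also have "card {e \<in> A \<inter> M i. \<exists>p\<in>Q. e \<subseteq> p} = (\<Sum>p\<in>Q. card {e \<in> A \<inter> M i. e \<subseteq> p})"
      using finAB ne P Q(1) by (intro card_edges_inside_pieces) (auto intro: finite_subset pairwise_subset)
    also have "card {e \<in> B \<inter> M i. \<exists>p\<in>P - Q. e \<subseteq> p} = (\<Sum>p\<in>P - Q. card {e \<in> B \<inter> M i. e \<subseteq> p})"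
      using finAB ne P by (intro card_edges_inside_pieces) (auto intro: pairwise_subset)
    finally have "real (card (C \<inter> M i)) = (\<Sum>p\<in>Q. num A p i) + (\<Sum>p\<in>P - Q. num B p i)"
      by (simp add: num_def)
    also have "\<dots> = (\<Sum>p\<in>P. num B p i) + (\<Sum>p\<in>Q. v p i)"
      using P(1) Q(1) by (simp add: v_def sum_subtractf sum_diff)
    also have "\<dots> = t * (\<Sum>p\<in>P. num A p i) + (1 - t) * (\<Sum>p\<in>P. num B p i) + ?d"
      by (simp add: v_def sum_subtractf algebra_simps)
    finally have eq: "real (card (C \<inter> M i)) = \<dots>" .
    have "t * (real (card (A \<inter> M i)) - card F) \<le> t * (\<Sum>p\<in>P. num A p i)"
      using lost[of A] t by (intro mult_left_mono) auto
    moreover have "(1 - t) * (real (card (B \<inter> M i)) - card F) \<le> (1 - t) * (\<Sum>p\<in>P. num B p i)"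
      using lost[of B] t by (intro mult_left_mono) auto
    moreover have "real (card F) \<le> 2 * card V / L"
    proof -
      have "real (L * card F) \<le> real (2 * card V)" using F(2) by (simp only: of_nat_le_iff)
      then show ?thesis using L by (simp add: field_simps)
    qed
    ultimately show ?thesis using eq dev by (simp add: algebra_simps)
  qed
  have "C \<subseteq> nsets V 2" using A(1) B(1) by (auto simp: C_def)
  with dC main show ?thesis by blast
qed

text \<open>
  Induction on the index set: a convex combination over \<open>insert j J\<close> is the combination of \<open>M j\<close>
  with weight \<open>w j\<close> and of a convex combination over \<open>J\<close>, with weights rescaled by
  \<open>1 / (1 - w j)\<close>. The errors add up, because the factor \<open>1 - w j\<close> only shrinks the earlier ones.
\<close>

lemma mix_matchings:
  fixes M :: "'i \<Rightarrow> 'a set set" and w :: "'i \<Rightarrow> real" and L :: nat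
  assumes V: "finite V" and I: "finite I" and L: "1 \<le> L"
    and M: "\<And>i. i \<in> I \<Longrightarrow> M i \<subseteq> nsets V 2" "\<And>i. i \<in> I \<Longrightarrow> disjoint (M i)"
    and J: "finite J" "J \<noteq> {}" "J \<subseteq> I" "\<And>i. i \<in> J \<Longrightarrow> 0 \<le> w i" "(\<Sum>i\<in>J. w i) = 1"
  shows "\<exists>C \<subseteq> nsets V 2. disjoint C \<and> (\<forall>i\<in>J. real (card (C \<inter> M i)) \<ge>
           w i * card (M i) - card J * (2 * card V / L + L * sqrt (card I * card V)))"
proof -
  define \<eta> where "\<eta> = 2 * card V / L + L * sqrt (card I * card V)"
  have eta: "0 \<le> \<eta>" by (simp add: \<eta>_def)
  show ?thesis
    unfolding \<eta>_def[symmetric] using J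
  proof (induction arbitrary: w rule: finite_ne_induct)
    case (singleton j)
    then show ?case using M[of j] eta by (intro exI[of _ "M j"]) auto
  next
    case (insert j J)
    have wj: "w j + (\<Sum>i\<in>J. w i) = 1" using insert by simp
    have sJ: "0 \<le> (\<Sum>i\<in>J. w i)" using insert.prems by (intro sum_nonneg) auto
    show ?case
    proof (cases "w j = 1")
      case True
      then have "\<forall>i\<in>J. w i = 0"
        using wj insert.hyps insert.prems by (subst sum_nonneg_eq_0_iff[symmetric]) auto
      then show ?thesis
        using True M[of j] insert.prems insert.hyps eta
        by (intro exI[of _ "M j"]) (auto intro: order_trans[of _ 0])
    next
      case False
      then have t: "0 < 1 - w j" "1 - w j \<le> 1" using wj sJ insert.prems by auto
      have "(\<Sum>i\<in>J. w i / (1 - w j)) = 1"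
        using wj t by (simp flip: sum_divide_distrib)
      then obtain C where C: "C \<subseteq> nsets V 2" "disjoint C"
        "\<forall>i\<in>J. real (card (C \<inter> M i)) \<ge> w i / (1 - w j) * card (M i) - card J * \<eta>"
        using insert.IH[of "\<lambda>i. w i / (1 - w j)"] insert.prems t by auto
      obtain D where D: "D \<subseteq> nsets V 2" "disjoint D"
        "\<forall>i\<in>I. real (card (D \<inter> M i)) \<ge>
           (1 - w j) * card (C \<inter> M i) + w j * card (M j \<inter> M i) - \<eta>"
        using mix_two_matchings[OF V C(1,2) M(1)[of j] M(2)[of j] I L, of "1 - w j" M]
          t insert.prems unfolding \<eta>_def by auto
      have "real (card (D \<inter> M i)) \<ge> w i * card (M i) - card (insert j J) * \<eta>"
        if i: "i \<in> insert j J" for i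
      proof (cases "i = j")
        case True
        have "real (card (D \<inter> M j)) \<ge>
           (1 - w j) * card (C \<inter> M j) + w j * card (M j \<inter> M j) - \<eta>"
          using D(3) insert.prems by blast
        moreover have "0 \<le> (1 - w j) * card (C \<inter> M j)" using t by simp
        moreover have "\<eta> \<le> card (insert j J) * \<eta>"
          using insert.hyps eta by (simp add: algebra_simps)
        ultimately show ?thesis using True by simp
      next
        case False
        with i have iJ: "i \<in> J" by simp
        have "(1 - w j) * (w i / (1 - w j) * card (M i) - card J * \<eta>) \<le> (1 - w j) * card (C \<inter> M i)"
          using C(3) iJ t by (intro mult_left_mono) auto
        moreover have "(1 - w j) * (w i / (1 - w j) * card (M i) - card J * \<eta>)
            = w i * card (M i) - (1 - w j) * (card J * \<eta>)"
          using t by (simp add: right_diff_distrib)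
        moreover have "(1 - w j) * (card J * \<eta>) \<le> 1 * (card J * \<eta>)"
          using t eta by (intro mult_right_mono) auto
        moreover have "0 \<le> w j * card (M j \<inter> M i)" using insert.prems by simp
        moreover have "real (card (D \<inter> M i)) \<ge>
           (1 - w j) * card (C \<inter> M i) + w j * card (M j \<inter> M i) - \<eta>"
          using D(3) iJ insert.prems by blast
        ultimately show ?thesis using insert.hyps by (simp add: algebra_simps)
      qed
      with D show ?thesis by blast
    qed
  qed
qed

section \<open>Prescribed intersections with perfect matchings\<close>

lemma card_perfect_matching:
  assumes "is_perfect_matching (complete_verts (2 * n)) (complete_edges (2 * n)) M"
  shows "card M = n"
proof -
  have M: "M \<subseteq> nsets {..<2 * n} 2" "disjoint M" "\<Union>M = {..<2 * n}"
    using assms by (auto simp: is_perfect_matching_def is_matching_def complete_verts_def complete_edges_def)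
  have "2 * n = card (\<Union>M)" using M(3) by simp
  also have "\<dots> = (\<Sum>e\<in>M. card e)" using M by (intro card_Union_disjoint) (auto simp: nsets_def)
  also have "\<dots> = (\<Sum>e\<in>M. 2)" using M(1) by (intro sum.cong) (auto simp: nsets_def)
  finally show ?thesis by simp
qed

theorem corollary5p1:
  fixes \<epsilon> \<alpha> :: real
  assumes "\<epsilon> > 0" and "\<alpha> > 0"
  shows "\<exists>n0::nat. \<forall>n\<ge>n0. \<forall>(k::nat) (a :: nat \<Rightarrow> real).
           (\<Sum>i=1..k. a i) \<le> (1 - \<epsilon>) * real n \<longrightarrow>
           (\<forall>i\<in>{1..k}. a i \<ge> \<alpha> * real n) \<longrightarrow>
           (\<forall>Ms :: nat \<Rightarrow> nat set set.
              (\<forall>i\<in>{1..k}. is_perfect_matching (complete_verts (2 * n)) (complete_edges (2 * n)) (Ms i)) \<longrightarrow>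
              disjoint_family_on Ms {1..k} \<longrightarrow>
              (\<exists>M. is_matching (complete_edges (2 * n)) M \<and>
                   (\<forall>i\<in>{1..k}. real (card (M \<inter> Ms i)) \<ge> a i)))"
proof -
  \<comment> \<open>\<open>c n\<close> is the surplus available to absorb the error. Each of the two error terms,
    multiplied by the bound \<open>K\<close> on the number of matchings, must be at most \<open>c n / 2\<close>: the choice of \<open>L\<close> ensures
    this for the deleted edges, that of \<open>n0\<close> for the rounding error.\<close>
  define c where "c = \<epsilon> * \<alpha>"
  have c: "0 < c" using assms by (simp add: c_def)
  obtain K :: nat where K: "1 / \<alpha> \<le> K" using real_arch_simple by blast
  have K0: "0 < K" using K assms(2) by (metis divide_pos_pos not_gr_zero of_nat_0 zero_less_one linorder_not_less)
  obtain L :: nat where L: "8 * K / c \<le> L" using real_arch_simple by blast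
  have L1: "1 \<le> L" using L c K0
    by (metis One_nat_def Suc_leI divide_pos_pos linorder_not_less mult_pos_pos not_gr_zero of_nat_0 of_nat_0_less_iff zero_less_numeral)
  obtain n0 :: nat where n0: "8 * K ^ 3 * L\<^sup>2 / c\<^sup>2 \<le> n0" using real_arch_simple by blast
  show ?thesis
  proof (intro exI[of _ "Suc n0"] allI impI)
    fix n k :: nat and a :: "nat \<Rightarrow> real" and Ms :: "nat \<Rightarrow> nat set set"
    assume n: "Suc n0 \<le> n" and s: "(\<Sum>i=1..k. a i) \<le> (1 - \<epsilon>) * real n"
      and a: "\<forall>i\<in>{1..k}. a i \<ge> \<alpha> * real n"
      and Ms: "\<forall>i\<in>{1..k}. is_perfect_matching (complete_verts (2 * n)) (complete_edges (2 * n)) (Ms i)"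
    have npos: "0 < real n" using n by simp
    define s where "s = (\<Sum>i=1..k. a i)"
    show "\<exists>M. is_matching (complete_edges (2 * n)) M \<and> (\<forall>i\<in>{1..k}. real (card (M \<inter> Ms i)) \<ge> a i)"
    proof (cases "k = 0")
      case True
      then show ?thesis by (intro exI[of _ "{}"]) (auto simp: is_matching_def)
    next
      case False
      have apos: "0 < a i" if "i \<in> {1..k}" for i
        using a that npos assms(2) by (meson less_le_trans mult_pos_pos)
      have spos: "0 < s" unfolding s_def using False apos by (intro sum_pos) auto
      have sle: "s \<le> n - \<epsilon> * n" using s by (simp add: s_def algebra_simps)
      have sn: "s \<le> n" using sle assms(1) npos by (smt (verit) mult_pos_pos)
      have kK: "k \<le> K"
      proof -
        have "real k * (\<alpha> * n) = (\<Sum>i=1..k. \<alpha> * n)" by simp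
        also have "\<dots> \<le> s" unfolding s_def using a by (intro sum_mono) auto
        finally have "real k * \<alpha> * n \<le> 1 * real n" using sn by simp
        then have "real k * \<alpha> \<le> 1" using npos by (simp only: mult_le_cancel_right_pos)
        then have "real k \<le> 1 / \<alpha>" using assms(2) by (simp add: field_simps)
        with K show ?thesis by linarith
      qed
      define \<eta> where "\<eta> = 2 * real (2 * n) / L + L * sqrt (k * real (2 * n))"
      have err: "k * \<eta> \<le> c * n"
      proof -
        have "K * (2 * real (2 * n) / L) \<le> c * n / 2"
        proof -
          have "8 * K \<le> c * L" using L c by (simp add: field_simps)
          then have "8 * K * real n \<le> c * L * n" by (intro mult_right_mono) auto
          then show ?thesis using L1 by (simp add: field_simps)
        qed
        moreover have "K * (L * sqrt (k * real (2 * n))) \<le> c * n / 2"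
        proof -
          have "8 * K ^ 3 * L\<^sup>2 / c\<^sup>2 \<le> n" using n0 n by linarith
          then have *: "8 * real K ^ 3 * L\<^sup>2 \<le> c\<^sup>2 * n" using c by (simp add: field_simps)
          have "(K * (L * sqrt (k * real (2 * n))))\<^sup>2 = 2 * real K ^ 2 * L\<^sup>2 * n * k"
            by (simp add: power_mult_distrib)
          also have "\<dots> \<le> 2 * real K ^ 2 * L\<^sup>2 * n * K"
            using kK by (intro mult_left_mono) auto
          also have "\<dots> = (8 * real K ^ 3 * L\<^sup>2) * (n / 4)"
            by (simp add: power3_eq_cube power2_eq_square)
          also have "\<dots> \<le> (c\<^sup>2 * n) * (n / 4)"
            using * by (intro mult_right_mono) auto
          also have "\<dots> = (c * n / 2)\<^sup>2" by (simp add: power2_eq_square)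
          finally show ?thesis by (rule power2_le_imp_le) (use c in simp)
        qed
        ultimately have "K * \<eta> \<le> c * n" unfolding \<eta>_def by (simp add: distrib_left)
        moreover have "k * \<eta> \<le> K * \<eta>" using kK by (intro mult_right_mono) (auto simp: \<eta>_def)
        ultimately show ?thesis by linarith
      qed
      have sub: "Ms i \<subseteq> nsets {..<2 * n} 2" "disjoint (Ms i)" if "i \<in> {1..k}" for i
        using Ms that
        by (auto simp: is_perfect_matching_def is_matching_def complete_verts_def complete_edges_def)
      have "\<exists>C \<subseteq> nsets {..<2 * n} 2. disjoint C \<and> (\<forall>i\<in>{1..k}. real (card (C \<inter> Ms i)) \<ge>
           a i / s * card (Ms i) - card {1..k} * (2 * card {..<2 * n} / L + L * sqrt (card {1..k} * card {..<2 * n})))"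
        using False sub apos spos L1
        by (intro mix_matchings) (auto simp: s_def less_imp_le simp flip: sum_divide_distrib)
      then obtain C where C: "C \<subseteq> nsets {..<2 * n} 2" "disjoint C"
        "\<And>i. i \<in> {1..k} \<Longrightarrow> real (card (C \<inter> Ms i)) \<ge> a i / s * card (Ms i) - k * \<eta>"
        by (auto simp: \<eta>_def)
      have "a i \<le> real (card (C \<inter> Ms i))" if i: "i \<in> {1..k}" for i
      proof -
        have "c * n = \<epsilon> * (\<alpha> * n)" by (simp add: c_def)
        also have "\<dots> \<le> \<epsilon> * a i" using a i assms(1) by (intro mult_left_mono) auto
        also have "\<dots> = a i * (\<epsilon> * n) / n" using npos by simp
        also have "\<dots> \<le> a i * (n - s) / n"
          using sle apos[OF i] npos by (intro divide_right_mono mult_left_mono) auto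
        also have "\<dots> \<le> a i * (n - s) / s"
          using sn spos apos[OF i] npos by (intro divide_left_mono) auto
        also have "\<dots> = a i / s * n - a i" using spos by (simp add: field_simps)
        finally have "a i \<le> a i / s * n - c * n" by simp
        also have "\<dots> \<le> a i / s * n - k * \<eta>" using err by simp
        also have "\<dots> \<le> real (card (C \<inter> Ms i))"
          using C(3)[OF i] card_perfect_matching[OF Ms[rule_format, OF i]] by simp
        finally show ?thesis .
      qed
      then show ?thesis
        using C(1,2) by (intro exI[of _ C]) (auto simp: is_matching_def complete_edges_def complete_verts_def)
    qed
  qed
qed

end
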